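(* Let $G=(\mathcal{Y},E)$ be an undirected graph on the sample space $\mathcal{Y}$, with adjacency sets $b(y)=\{z\in\mathcal{Y}\mid (y,z)\in E\}$. Let $\mathcal{Y}_0\subset\mathcal{Y}$ satisfy $\bigcup_{y\in\mathcal{Y}_0} b(y)=\mathcal{Y}$. Define the graph $G_0'=(\mathcal{Y}_0,E_0')$ by $$(y,y')\in E_0'\iff y\neq y'\ \text{and}\ b(y)\cap b(y')\neq\emptyset .$$ Assume that $G_0'$ is connected and that all functions in $\Phi=\{\phi_y\mid y\in\mathcal{Y}_0\}$ are local pseudo-spherical potentials, i.e., for a constant $\gamma>0$, $$\phi_y(f)=\Big(\sum_{z\in b(y)}f_z^{1+\gamma}\Big)^{1/(1+\gamma)},\qquad f\in\mathbb{R}_{++}^{b(y)},\ y\in\mathcal{Y}_0 .$$ Then the composite local Bregman divergence $D_\Phi$ satisfies the coincidence axiom on $\mathcal{P}$, i.e., for all $p,q\in\mathcal{P}$, $D_\Phi(p,q)=0$ implies $p=q$.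
   Context: $\mathcal{Y}$ is a finite discrete sample space. $\mathbb{R}_{++}=\{x\in\mathbb{R}\mid x>0\}$, and for an index set $A$, $\mathbb{R}_{++}^{A}$ is the set of functions $A\to\mathbb{R}_{++}$, written as vectors $(a_z)_{z\in A}$. $\mathcal{F}=\mathbb{R}_{++}^{\mathcal{Y}}$ and $\mathcal{P}=\{p\in\mathcal{F}\mid\sum_{y\in\mathcal{Y}}p_y=1\}$. Graphs are undirected ($(y,z)$ and $(z,y)$ denote the same edge) and have no loops; in particular $y\notin b(y)$. For $f\in\mathcal{F}$ and $y\in\mathcal{Y}$, $f_{b(y)}/f_y$ denotes the vector $(f_z/f_y)_{z\in b(y)}\in\mathbb{R}_{++}^{b(y)}$. For a differentiable convex function $\phi_y:\mathbb{R}_{++}^{b(y)}\to\mathbb{R}$, its Bregman divergence is, for $u,v\in\mathbb{R}_{++}^{b(y)}$, $$D_{\phi_y}(u,v)=\phi_y(u)-\phi_y(v)-\sum_{z\in b(y)}\partial_z\phi_y(v)(u_z-v_z),$$ where $\partial_z$ is the partial derivative with respect to the coordinate indexed by $z$. The composite local Bregman divergence of $\Phi=\{\phi_y\mid y\in\mathcal{Y}_0\}$ is $$D_\Phi(f,g)=\sum_{y\in\mathcal{Y}_0}f_y\,D_{\phi_y}\big(f_{b(y)}/f_y,\;g_{b(y)}/g_y\big),\qquad f,g\in\mathcal{F}.$$ *)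

theory Defs
  imports
    "HOL-Analysis.Analysis"
    "Graph_Theory.Digraph_Component"
begin

text \<open>
  The sample space is the finite vertex set of a graph, and vectors indexed by a set \<open>A\<close> are
  extensional functions (with the value \<open>undefined\<close> outside \<open>A\<close>), so that equality of vectors is
  equality of functions.  Undirected loop-free graphs are symmetric, irreflexive sets of pairs
  (locale \<open>pair_graph\<close>).
\<close>

definition pos_vecs :: "'y set \<Rightarrow> ('y \<Rightarrow> real) set" where
  "pos_vecs A = A \<rightarrow>\<^sub>E {0<..}"

definition prob_vecs :: "'y set \<Rightarrow> ('y \<Rightarrow> real) set" where
  "prob_vecs Y = {p \<in> pos_vecs Y. (\<Sum>y\<in>Y. p y) = 1}"

definition nbhd :: "'y pair_pre_digraph \<Rightarrow> 'y \<Rightarrow> 'y set" where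
  "nbhd G y = {z \<in> pverts G. (y, z) \<in> parcs G}"

definition common_nbr_graph :: "'y pair_pre_digraph \<Rightarrow> 'y set \<Rightarrow> 'y pair_pre_digraph" where
  "common_nbr_graph G Y0 =
     \<lparr> pverts = Y0,
       parcs = {(y, y'). y \<in> Y0 \<and> y' \<in> Y0 \<and> y \<noteq> y' \<and> nbhd G y \<inter> nbhd G y' \<noteq> {}} \<rparr>"

definition local_ratio :: "'y set \<Rightarrow> ('y \<Rightarrow> real) \<Rightarrow> 'y \<Rightarrow> ('y \<Rightarrow> real)" where
  "local_ratio A f y = (\<lambda>z\<in>A. f z / f y)"

text \<open>
  At \<open>v \<in> pos_vecs A\<close> and \<open>z \<in> A\<close> this depends only on the values of \<open>\<phi>\<close> on \<open>pos_vecs A\<close>, as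
  \<open>v(z := t)\<close> stays in that set for \<open>t\<close> near \<open>v z\<close>.
\<close>
definition partial_deriv :: "(('y \<Rightarrow> real) \<Rightarrow> real) \<Rightarrow> 'y \<Rightarrow> ('y \<Rightarrow> real) \<Rightarrow> real" where
  "partial_deriv \<phi> z v = deriv (\<lambda>t. \<phi> (v(z := t))) (v z)"

definition bregman ::
  "'y set \<Rightarrow> (('y \<Rightarrow> real) \<Rightarrow> real) \<Rightarrow> ('y \<Rightarrow> real) \<Rightarrow> ('y \<Rightarrow> real) \<Rightarrow> real" where
  "bregman A \<phi> u v = \<phi> u - \<phi> v - (\<Sum>z\<in>A. partial_deriv \<phi> z v * (u z - v z))"

definition composite_bregman ::
  "'y pair_pre_digraph \<Rightarrow> 'y set \<Rightarrow> ('y \<Rightarrow> ('y \<Rightarrow> real) \<Rightarrow> real)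
    \<Rightarrow> ('y \<Rightarrow> real) \<Rightarrow> ('y \<Rightarrow> real) \<Rightarrow> real" where
  "composite_bregman G Y0 \<Phi> f g =
     (\<Sum>y\<in>Y0. f y * bregman (nbhd G y) (\<Phi> y)
                      (local_ratio (nbhd G y) f y) (local_ratio (nbhd G y) g y))"

text \<open>The values of a potential outside \<open>pos_vecs A\<close> are left unconstrained.\<close>
definition local_pseudo_spherical :: "real \<Rightarrow> 'y set \<Rightarrow> (('y \<Rightarrow> real) \<Rightarrow> real) \<Rightarrow> bool" where
  "local_pseudo_spherical \<gamma> A \<phi> \<longleftrightarrow>
     (\<forall>f\<in>pos_vecs A. \<phi> f = (\<Sum>z\<in>A. f z powr (1 + \<gamma>)) powr (1 / (1 + \<gamma>)))"

text \<open>\<open>D p p = 0\<close> is not part of the axiom.\<close>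
definition coincidence_axiom_on :: "'v set \<Rightarrow> ('v \<Rightarrow> 'v \<Rightarrow> real) \<Rightarrow> bool" where
  "coincidence_axiom_on P D \<longleftrightarrow> (\<forall>p\<in>P. \<forall>q\<in>P. D p q = 0 \<longrightarrow> p = q)"

end

theory Submission
  imports Defs
begin

text \<open>
  A pseudo-spherical potential is the \<open>\<ell>\<^sup>\<alpha>\<close>-norm with \<open>\<alpha> = 1 + \<gamma>\<close>.  It is positively homogeneous,
  so by Euler's identity its Bregman divergence is \<open>\<phi> u - (\<Sum>z. \<partial>\<^sub>z\<phi>(v) * u z)\<close>, which by Hoelder's
  inequality is nonnegative and vanishes only if \<open>u\<close> and \<open>v\<close> are proportional.  Hence
  \<open>D p q = 0\<close> forces \<open>p\<close> to be a multiple of \<open>q\<close> on each neighbourhood.  Overlapping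
  neighbourhoods share the factor, so connectedness makes it global, and normalisation makes it 1.
\<close>

section \<open>Strict convexity of powers and Hoelder's inequality\<close>

lemma powr_gt_tangent_at_one:
  fixes x a :: real
  assumes "x > 0" "x \<noteq> 1" "a > 1"
  shows "1 + a * (x - 1) < x powr a"
proof -
  have der: "((\<lambda>t. t powr a) has_real_derivative a * t powr (a - 1)) (at t)" if "t > 0" for t
    using that by (auto intro!: derivative_eq_intros)
  consider "x > 1" | "x < 1" using assms(2) by linarith
  then show ?thesis
  proof cases
    case 1
    \<comment> \<open>The secant slope equals the derivative at some \<open>t > 1\<close>, hence
      exceeds the tangent slope \<open>a\<close>; the other case mirrors this.\<close>
    obtain t where t: "1 < t" "t < x" "x powr a - 1 powr a = (x - 1) * (a * t powr (a - 1))"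
      using MVT2[of 1 x "\<lambda>t. t powr a" "\<lambda>t. a * t powr (a - 1)"] 1 der by force
    have "1 < t powr (a - 1)" using t assms(3) powr_less_mono2[of "a - 1" 1 t] by simp
    then have "(x - 1) * (a * 1) < (x - 1) * (a * t powr (a - 1))"
      using 1 assms(3) by (intro mult_strict_left_mono) auto
    then show ?thesis using t(3) by (simp add: algebra_simps)
  next
    case 2
    obtain t where t: "x < t" "t < 1" "1 powr a - x powr a = (1 - x) * (a * t powr (a - 1))"
      using MVT2[of x 1 "\<lambda>t. t powr a" "\<lambda>t. a * t powr (a - 1)"] 2 der assms(1) by force
    have "t powr (a - 1) < 1" using t assms powr_less_mono2[of "a - 1" t 1] by simp
    then have "(1 - x) * (a * t powr (a - 1)) < (1 - x) * (a * 1)"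
      using 2 assms(3) by (intro mult_strict_left_mono) auto
    then show ?thesis using t(3) by (simp add: algebra_simps)
  qed
qed

text \<open>Scaling reduces this to the tangent at 1: apply that case to \<open>x / b\<close> and
  multiply by \<open>b powr a\<close>.\<close>

lemma powr_gt_tangent:
  fixes x b a :: real
  assumes "x > 0" "b > 0" "x \<noteq> b" "a > 1"
  shows "b powr a + a * b powr (a - 1) * (x - b) < x powr a"
proof -
  have "b powr a * (1 + a * (x / b - 1)) < b powr a * (x / b) powr a"
    using assms by (intro mult_strict_left_mono powr_gt_tangent_at_one) auto
  moreover have "b powr a * (x / b) powr a = x powr a"
    using assms by (simp add: powr_divide)
  moreover have "b powr a = b powr (a - 1) * b"
    using assms powr_mult_base[of b "a - 1"] by (simp add: mult.commute)
  then have "b powr a * (1 + a * (x / b - 1)) = b powr a + a * b powr (a - 1) * (x - b)"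
    using assms by (simp add: field_simps)
  ultimately show ?thesis by simp
qed

text \<open>Hoelder's inequality with its equality case: \<open>b z powr (a - 1)\<close> has norm 1
  for the conjugate exponent \<open>a / (a - 1)\<close>. It follows by summing the tangent
  inequalities at the points \<open>b z\<close>.\<close>

lemma normalized_holder:
  fixes x b :: "'i \<Rightarrow> real" and a :: real
  assumes "finite A" "a > 1" "\<And>z. z \<in> A \<Longrightarrow> x z > 0" "\<And>z. z \<in> A \<Longrightarrow> b z > 0"
    and "(\<Sum>z\<in>A. x z powr a) = 1" "(\<Sum>z\<in>A. b z powr a) = 1"
  shows "(\<Sum>z\<in>A. b z powr (a - 1) * x z) \<le> 1"
    and "(\<Sum>z\<in>A. b z powr (a - 1) * x z) = 1 \<Longrightarrow> z \<in> A \<Longrightarrow> x z = b z"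
proof -
  define gap where "gap z = x z powr a - (b z powr a + a * b z powr (a - 1) * (x z - b z))" for z
  have gap_pos: "gap z > 0" if "z \<in> A" "x z \<noteq> b z" for z
    using powr_gt_tangent[of "x z" "b z" a] that assms unfolding gap_def by simp
  have gap_nonneg: "gap z \<ge> 0" if "z \<in> A" for z
    using gap_pos[OF that] by (cases "x z = b z") (auto simp: gap_def)
  have "gap z = x z powr a - b z powr a - a * (b z powr (a - 1) * x z) + a * b z powr a"
    if "z \<in> A" for z
    using powr_mult_base[of "b z" "a - 1"] assms(4)[OF that]
    by (simp add: gap_def algebra_simps)
  then have "sum gap A = (\<Sum>z\<in>A. x z powr a - b z powr a - a * (b z powr (a - 1) * x z) + a * b z powr a)"
    by (intro sum.cong) auto
  \<comment> \<open>The first two sums are both 1 and cancel; the last one contributes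
    \<open>a\<close>.\<close>
  also have "\<dots> = a * (1 - (\<Sum>z\<in>A. b z powr (a - 1) * x z))"
    by (simp add: sum.distrib sum_subtractf assms(5,6) flip: sum_distrib_left)
      (simp add: algebra_simps)
  finally have eq: "sum gap A = a * (1 - (\<Sum>z\<in>A. b z powr (a - 1) * x z))" .
  have "sum gap A \<ge> 0" using gap_nonneg by (rule sum_nonneg)
  then show "(\<Sum>z\<in>A. b z powr (a - 1) * x z) \<le> 1"
    using assms(2) by (simp add: eq zero_le_mult_iff)
  assume "(\<Sum>z\<in>A. b z powr (a - 1) * x z) = 1" "z \<in> A"
  then have "gap z = 0"
    using eq gap_nonneg assms(1) by (simp add: sum_nonneg_eq_0_iff)
  then show "x z = b z" using gap_pos \<open>z \<in> A\<close> by force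
qed

section \<open>The power norm, its gradient and its Bregman divergence\<close>

definition power_norm :: "real \<Rightarrow> 'i set \<Rightarrow> ('i \<Rightarrow> real) \<Rightarrow> real" where
  "power_norm a A u = (\<Sum>z\<in>A. u z powr a) powr (1 / a)"

lemma pos_vecs_pos: "u \<in> pos_vecs A \<Longrightarrow> z \<in> A \<Longrightarrow> u z > 0"
  by (auto simp: pos_vecs_def)

lemma sum_powr_pos:
  assumes "finite A" "A \<noteq> {}" "u \<in> pos_vecs A"
  shows "(\<Sum>z\<in>A. u z powr a) > 0"
  using assms by (intro sum_pos) (auto dest: pos_vecs_pos)

lemma power_norm_normalizes:
  assumes "finite A" "A \<noteq> {}" "u \<in> pos_vecs A" "a > 1"
  shows "power_norm a A u > 0" "(\<Sum>z\<in>A. (u z / power_norm a A u) powr a) = 1"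
proof -
  let ?S = "\<Sum>z\<in>A. u z powr a"
  have S: "?S > 0" using sum_powr_pos assms by blast
  then show pos: "power_norm a A u > 0" by (simp add: power_norm_def)
  have "(\<Sum>z\<in>A. (u z / power_norm a A u) powr a) = (\<Sum>z\<in>A. u z powr a / ?S)"
    using assms S pos
    by (intro sum.cong) (auto simp: powr_divide power_norm_def powr_powr dest!: pos_vecs_pos)
  then show "(\<Sum>z\<in>A. (u z / power_norm a A u) powr a) = 1"
    using S by (simp flip: sum_divide_distrib)
qed

text \<open>The chain rule gives this; the form in the normalised vector is the one that enters
  Hoelder's inequality.\<close>

lemma partial_deriv_pseudo_spherical:
  assumes "finite A" "v \<in> pos_vecs A" "z \<in> A" "\<gamma> > 0" "local_pseudo_spherical \<gamma> A \<phi>"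
  shows "partial_deriv \<phi> z v = (v z / power_norm (1 + \<gamma>) A v) powr \<gamma>"
proof -
  define a where "a = 1 + \<gamma>"
  have a: "a > 1" using assms by (simp add: a_def)
  \<comment> \<open>The coordinates other than \<open>z\<close> stay fixed, which leaves the
    one-variable function \<open>(C + t powr a) powr (1 / a)\<close>.\<close>
  define C where "C = (\<Sum>w\<in>A-{z}. v w powr a)"
  have vz: "v z > 0" using assms pos_vecs_pos by metis
  have C: "C + v z powr a = (\<Sum>w\<in>A. v w powr a)"
    unfolding C_def by (simp add: sum.remove[OF assms(1,3)])
  have S: "C + v z powr a > 0" using sum_powr_pos[of A v a] assms C by auto
  have ph: "\<phi> (v(z := t)) = (C + t powr a) powr (1 / a)" if "t > 0" for t
  proof -
    have "v(z := t) \<in> pos_vecs A"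
      using assms that by (auto simp: pos_vecs_def PiE_iff extensional_def)
    then have "\<phi> (v(z := t)) = (\<Sum>w\<in>A. (v(z := t)) w powr a) powr (1 / a)"
      using assms(5) by (simp add: local_pseudo_spherical_def a_def)
    also have "(\<Sum>w\<in>A. (v(z := t)) w powr a) = C + t powr a"
      unfolding C_def by (simp add: sum.remove[OF assms(1,3)])
    finally show ?thesis .
  qed
  have "((\<lambda>t. (C + t powr a) powr (1 / a)) has_real_derivative
      (1 / a) * (C + v z powr a) powr (1 / a - 1) * (a * v z powr (a - 1))) (at (v z))"
    using vz S a by (auto intro!: derivative_eq_intros)
  then have "deriv (\<lambda>t. (C + t powr a) powr (1 / a)) (v z) =
      (C + v z powr a) powr (1 / a - 1) * v z powr (a - 1)"
    using a by (simp add: DERIV_imp_deriv)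
  \<comment> \<open>The potential is prescribed only for \<open>t > 0\<close>, but this is a
    neighbourhood of \<open>v z\<close>, which determines the derivative.\<close>
  moreover have "\<forall>\<^sub>F t in nhds (v z). \<phi> (v(z := t)) = (C + t powr a) powr (1 / a)"
    using eventually_nhds_in_open[of "{0<..}" "v z"] vz ph by (auto elim: eventually_mono)
  then have "deriv (\<lambda>t. \<phi> (v(z := t))) (v z) = deriv (\<lambda>t. (C + t powr a) powr (1 / a)) (v z)"
    by (intro deriv_cong_ev) auto
  moreover have "(1 / a) * (1 - a) = 1 / a - 1" using a by (simp add: field_simps)
  then have "power_norm a A v powr (1 - a) = (C + v z powr a) powr (1 / a - 1)"
    using C by (simp add: power_norm_def powr_powr)
  moreover have "(v z / power_norm a A v) powr (a - 1) = power_norm a A v powr (1 - a) * v z powr (a - 1)"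
    using vz powr_minus_divide[of "power_norm a A v" "a - 1"]
    by (simp add: powr_divide power_norm_def)
  ultimately show ?thesis
    by (simp add: partial_deriv_def a_def)
qed

text \<open>By Euler's identity the terms in \<open>v\<close> alone cancel; what remains is
  \<open>M\<close> times the defect in Hoelder's inequality for the normalised vectors
  \<open>x\<close> and \<open>b\<close>.\<close>

lemma bregman_pseudo_spherical:
  assumes "finite A" "u \<in> pos_vecs A" "v \<in> pos_vecs A" "\<gamma> > 0" "local_pseudo_spherical \<gamma> A \<phi>"
  shows "bregman A \<phi> u v \<ge> 0"
    and "bregman A \<phi> u v = 0 \<Longrightarrow> \<exists>k. \<forall>z\<in>A. u z = k * v z"
proof -
  define a where "a = 1 + \<gamma>"
  define M where "M = power_norm a A u"
  define N where "N = power_norm a A v"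
  define x where "x z = u z / M" for z
  define b where "b z = v z / N" for z
  have a: "a > 1" using assms by (simp add: a_def)
  have *: "bregman A \<phi> u v \<ge> 0 \<and> (bregman A \<phi> u v = 0 \<longrightarrow> (\<exists>k. \<forall>z\<in>A. u z = k * v z))"
  proof (cases "A = {}")
    \<comment> \<open>Here the norms vanish and cannot be divided by, but the only vector over the
      empty set is the constant \<open>undefined\<close>.\<close>
    case True
    then have "u = v" using assms(2,3) by (auto simp: pos_vecs_def)
    then show ?thesis using True by (simp add: bregman_def)
  next
    case False
    have M: "M > 0" "(\<Sum>z\<in>A. x z powr a) = 1"
      using power_norm_normalizes[OF assms(1) False assms(2) a] by (auto simp: M_def x_def)
    have N: "N > 0" "(\<Sum>z\<in>A. b z powr a) = 1"
      using power_norm_normalizes[OF assms(1) False assms(3) a] by (auto simp: N_def b_def)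
    have pos: "\<And>z. z \<in> A \<Longrightarrow> x z > 0" "\<And>z. z \<in> A \<Longrightarrow> b z > 0"
      using assms(2,3) M(1) N(1) by (auto simp: x_def b_def dest: pos_vecs_pos)
    have "b z * b z powr (a - 1) = b z powr a" if "z \<in> A" for z
      using powr_mult_base[of "b z" "a - 1"] pos(2)[OF that] by simp
    then have bb: "(\<Sum>z\<in>A. b z * b z powr (a - 1)) = 1"
      using N(2) by (simp cong: sum.cong)
    \<comment> \<open>Substitute \<open>u z = M * x z\<close> and \<open>v z = N * b z\<close>; the
      second part sums to \<open>N\<close>, which is the value of the potential at
      \<open>v\<close>.\<close>
    have "(\<Sum>z\<in>A. partial_deriv \<phi> z v * (u z - v z)) =
        (\<Sum>z\<in>A. M * (b z powr (a - 1) * x z) - N * (b z * b z powr (a - 1)))"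
      using partial_deriv_pseudo_spherical[OF assms(1,3) _ assms(4,5)] M N
      by (intro sum.cong) (auto simp: b_def x_def N_def a_def algebra_simps)
    also have "\<dots> = M * (\<Sum>z\<in>A. b z powr (a - 1) * x z) - N"
      using bb by (simp add: sum_subtractf flip: sum_distrib_left)
    finally have D: "bregman A \<phi> u v = M * (1 - (\<Sum>z\<in>A. b z powr (a - 1) * x z))"
      using assms(2,3,5)
      by (simp add: bregman_def local_pseudo_spherical_def M_def N_def power_norm_def a_def
          algebra_simps)
    note H = normalized_holder[OF assms(1) a pos M(2) N(2)]
    \<comment> \<open>Equality in Hoelder's inequality means \<open>u z / M = v z / N\<close>, so
      the factor is the ratio of the norms.\<close>
    have "u z = (M / N) * v z" if "bregman A \<phi> u v = 0" "z \<in> A" for z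
    proof -
      have "x z = b z" using H(2) that D M(1) by simp
      then show ?thesis using M(1) N(1) by (simp add: x_def b_def field_simps)
    qed
    then have "bregman A \<phi> u v = 0 \<longrightarrow> (\<exists>k. \<forall>z\<in>A. u z = k * v z)" by blast
    then show ?thesis using H(1) D M(1) by simp
  qed
  then show "bregman A \<phi> u v \<ge> 0" by blast
  show "bregman A \<phi> u v = 0 \<Longrightarrow> \<exists>k. \<forall>z\<in>A. u z = k * v z" using * by blast
qed

section \<open>From local proportionality to a global factor\<close>

lemma local_ratio_pos_vecs:
  assumes "f \<in> pos_vecs Y" "A \<subseteq> Y" "y \<in> Y"
  shows "local_ratio A f y \<in> pos_vecs A"
  using assms by (auto simp: pos_vecs_def local_ratio_def PiE_iff)

text \<open>Connectedness is reachability in the symmetric closure, so induction along a path meets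
  arcs of \<open>G\<close> in either direction, and \<open>c\<close> agrees at both ends of
  each.\<close>

lemma connected_constant:
  assumes conn: "Digraph_Component.connected G"
    and arc: "\<And>u v. u \<rightarrow>\<^bsub>G\<^esub> v \<Longrightarrow> c u = c v"
    and "u \<in> verts G" "v \<in> verts G"
  shows "c u = c v"
proof -
  have "u \<rightarrow>\<^sup>*\<^bsub>with_proj (mk_symmetric G)\<^esub> v"
    using conn assms(3,4) by (auto simp: connected_def strongly_connected_def)
  then show ?thesis
    unfolding reachable_def
  proof (induction rule: rtrancl_on.induct)
    case (rtrancl_on_into_rtrancl_on u v w)
    then have "v \<rightarrow>\<^bsub>G\<^esub> w \<or> w \<rightarrow>\<^bsub>G\<^esub> v"
      by (auto simp: mk_symmetric_def arcs_ends_conv)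
    then show ?case using arc[of v w] arc[of w v] rtrancl_on_into_rtrancl_on.IH by auto
  qed simp
qed

theorem theorem5:
  fixes G :: "'y pair_pre_digraph"
    and Y0 :: "'y set"
    and \<Phi> :: "'y \<Rightarrow> ('y \<Rightarrow> real) \<Rightarrow> real"
    and \<gamma> :: real
  assumes "pair_graph G"
    and "Y0 \<subseteq> pverts G"
    and "(\<Union>y\<in>Y0. nbhd G y) = pverts G"
    and "Digraph_Component.connected (with_proj (common_nbr_graph G Y0))"
    and "\<gamma> > 0"
    and "\<And>y. y \<in> Y0 \<Longrightarrow> local_pseudo_spherical \<gamma> (nbhd G y) (\<Phi> y)"
  shows "coincidence_axiom_on (prob_vecs (pverts G)) (composite_bregman G Y0 \<Phi>)"
  unfolding coincidence_axiom_on_def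
proof (intro ballI impI)
  fix p q
  assume p: "p \<in> prob_vecs (pverts G)" and q: "q \<in> prob_vecs (pverts G)"
    and D: "composite_bregman G Y0 \<Phi> p q = 0"
  interpret pair_graph G by fact
  let ?Y = "pverts G" and ?b = "nbhd G"
  let ?D = "\<lambda>y. bregman (?b y) (\<Phi> y) (local_ratio (?b y) p y) (local_ratio (?b y) q y)"
  have fin: "finite ?Y" by simp
  have b: "?b y \<subseteq> ?Y" "finite (?b y)" for y
    using finite_subset[OF _ fin] by (auto simp: nbhd_def)
  have pv: "p \<in> pos_vecs ?Y" "q \<in> pos_vecs ?Y" and
    norm: "sum p ?Y = 1" "sum q ?Y = 1"
    using p q by (auto simp: prob_vecs_def)
  have pos: "p z > 0" "q z > 0" if "z \<in> ?Y" for z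
    using pv that by (auto dest: pos_vecs_pos)
  have ratio: "local_ratio (?b y) p y \<in> pos_vecs (?b y)"
    "local_ratio (?b y) q y \<in> pos_vecs (?b y)" if "y \<in> Y0" for y
    using that assms(2) pv b by (auto intro!: local_ratio_pos_vecs)
  have D_nonneg: "?D y \<ge> 0" if "y \<in> Y0" for y
    using bregman_pseudo_spherical(1)[OF b(2) ratio[OF that] assms(5) assms(6)[OF that]] .
  have D0: "?D y = 0" if "y \<in> Y0" for y
  proof -
    have "p y > 0" using that assms(2) pos by blast
    \<comment> \<open>A vanishing sum of nonnegative terms has only zero terms; the positive weight
      \<open>p y\<close> then cancels.\<close>
    moreover have "\<forall>y\<in>Y0. p y * ?D y = 0"
      using D D_nonneg pos(1)[THEN less_imp_le] assms(2) finite_subset[OF assms(2) fin]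
      unfolding composite_bregman_def
      by (subst (asm) sum_nonneg_eq_0_iff) (auto intro!: mult_nonneg_nonneg)
    ultimately show ?thesis using that by force
  qed
  have "\<exists>c. \<forall>z\<in>?b y. p z = c * q z" if y: "y \<in> Y0" for y
  proof -
    obtain k where "\<forall>z\<in>?b y. local_ratio (?b y) p y z = k * local_ratio (?b y) q y z"
      using bregman_pseudo_spherical(2)[OF b(2) ratio[OF y] assms(5) assms(6)[OF y] D0[OF y]]
      by blast
    moreover have "p y > 0" "q y > 0" using y assms(2) pos by blast+
    \<comment> \<open>Clearing the denominators \<open>p y\<close> and \<open>q y\<close> of the
      local ratios changes the factor from \<open>k\<close> to this one.\<close>
    ultimately have "\<forall>z\<in>?b y. p z = (k * p y / q y) * q z"
      by (simp add: local_ratio_def field_simps)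
    then show ?thesis by blast
  qed
  then obtain c where c: "\<And>y z. y \<in> Y0 \<Longrightarrow> z \<in> ?b y \<Longrightarrow> p z = c y * q z"
    by metis
  let ?H = "with_proj (common_nbr_graph G Y0)"
  have "c y = c y'" if "y \<rightarrow>\<^bsub>?H\<^esub> y'" for y y'
  proof -
    \<comment> \<open>Adjacent vertices share a neighbour \<open>z\<close>, where both factors turn
      \<open>q z > 0\<close> into the same \<open>p z\<close>.\<close>
    from that obtain z where z: "y \<in> Y0" "y' \<in> Y0" "z \<in> ?b y" "z \<in> ?b y'"
      by (auto simp: common_nbr_graph_def)
    then have "c y * q z = c y' * q z" using c by metis
    moreover have "q z > 0" using z b pos by blast
    ultimately show ?thesis by simp
  qed
  then have const: "c y = c y'" if "y \<in> Y0" "y' \<in> Y0" for y y'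
    using connected_constant[OF assms(4), of c y y'] that by (simp add: common_nbr_graph_def)
  then obtain k where "\<And>y. y \<in> Y0 \<Longrightarrow> c y = k" by metis
  \<comment> \<open>The neighbourhoods cover \<open>?Y\<close>, so the common factor is valid
    everywhere.\<close>
  then have pk: "p z = k * q z" if "z \<in> ?Y" for z
    using that assms(3) c by (metis UN_E)
  then have "sum p ?Y = k * sum q ?Y" by (simp add: sum_distrib_left)
  then have "k = 1" using norm by simp
  then show "p = q"
    \<comment> \<open>Outside \<open>?Y\<close> both functions are \<open>undefined\<close>, so
      agreement on \<open>?Y\<close> is equality.\<close>
    using pk pv by (auto simp: pos_vecs_def intro: PiE_ext)
qed

end
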